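(* Consider the Partial-Anchor quantum routing protocol $\mathcal{QR}$ (defined in the context) on a finite set $V_2$ of at least two ESPs, with an isotone entangling-cost metric $w$ with composition operation $\oplus$, with e-neighborhoods $N(\cdot)$ and anchor set $T\subseteq V_2$, such that every ESP has at least one anchor in its e-neighborhood. Let $\mathscr{ES}=\max_{v_a\neq v_b\in V_2}\mathscr{ES}(a,b)$ be the overall entangling stretch of the protocol, and let $v_i\neq v_d$ be a pair of ESPs attaining this maximum (a worst-case pair). Then $$\mathscr{ES}\;\le\;\frac{w\big((i,d)\oplus(i,d)\oplus(i,d)\oplus(i,d)\oplus(i,d)\big)}{w(i,d)},$$ where the numerator is the five-fold composition $w(i,d)\oplus w(i,d)\oplus w(i,d)\oplus w(i,d)\oplus w(i,d)$. In particular, if the metric is additive, i.e. $\oplus$ is ordinary addition ($w(a\oplus b)=w(a)+w(b)$), then $\mathscr{ES}\le 5$. If the metric is concave, i.e. $\oplus=\min$, then $\mathscr{ES}=1$.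
   Context: Setting. $V_2$ is a finite set of nodes called ESPs (entanglement service providers), written $v_i,v_j,\dots$; a pair $(i,j)$ stands for $(v_i,v_j)$. Entangling-cost metric. $w(i,j)\in\mathbb{R}_{\ge 0}$ is the cost of establishing entanglement between $v_i$ and $v_j$. Costs are compared with the order $<$ of $\mathbb{R}$ and composed with an associative binary operation $\oplus$; the cost of a path is the composition of the costs of its links in order, e.g. $w\big((i,k)\oplus(k,j)\big)=w(i,k)\oplus w(k,j)$. The following are assumed for all $v_i,v_j,v_k$: definiteness: $w(i,j)=0\iff v_i=v_j$; non-negativity: $w(i,j)\ge 0$; symmetry: $w(i,j)=w(j,i)$; triangle inequality: $w(i,j)\le w\big((i,k)\oplus(k,j)\big)$; isotonicity: for costs $a<b$ of links or paths and any cost $c$ of a link or path, $c\oplus a<c\oplus b$ (left-isotone) and $a\oplus c<b\oplus c$ (right-isotone). For a path $R$ from $v_i$ to $v_j$ (a sequence of intermediate ESPs at which entanglement swapping is performed), $w_R(i,j)$ denotes the cost of the path; $w(i,j)$ is the optimal end-to-end cost, $w(i,j)=\min_R w_R(i,j)$. Stretch. If the routing protocol $\mathcal{QR}$ selects the path $R=\mathcal{QR}(i,j)$ for the pair of distinct ESPs $v_i,v_j$, then $\mathscr{ES}(i,j)=w_R(i,j)/w(i,j)$. e-neighborhoods and anchors. For a fixed positive integer $k$, $N(v)$ is a set of $k$ ESPs closest to $v$ with respect to $w$, i.e. $|N(v)|=k$ and $w(v,x)\le w(v,y)$ for every $x\in N(v)$ and every $y\in V_2\setminus N(v)$, $y\neq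 v$. The anchor set is a subset $T\subseteq V_2$ (its elements are called anchors). Assumption: $N(v)\cap T\neq\emptyset$ for every $v\in V_2$. Pre-established (artificial) links. Each $v$ keeps entanglement, at the optimal cost $w$, with every node of $N(v)$, and hence also with every node $u$ such that $v\in N(u)$ (a link is recorded in the routing tables of both of its endpoints). Any two anchors keep entanglement with each other at the optimal cost $w$. Partial-Anchor routing protocol. To connect an initiating ESP $v_i$ with a target ESP $v_d\ne v_i$, the first applicable case below is used. Case I: $v_i$ and $v_d$ already share an artificial link, i.e. $v_d\in N(v_i)$, or $v_i\in N(v_d)$, or both $v_i,v_d\in T$. The selected path is the direct link $(i,d)$. Case II: there is $v_j\in N(v_i)$ with $v_d\in N(v_j)$. The selected path is $(i,j)\oplus(j,d)$ for some such $v_j$. Case III: otherwise, choose an anchor $v_l\in T\cap N(v_i)$ and an anchor $v_k\in T\cap N(v_d)$; the selected path is $(i,l)\oplus(l,k)\oplus(k,d)$. If $v_i\in T$ one takes $v_l=v_i$, and if $v_d\in T$ one takes $v_k=v_d$; links from a node to itself are omitted from the path. *)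

theory Defs
  imports Complex_Main
begin

text \<open>A path is the list of all its nodes, end points included. Like the sequences of
  intermediate nodes it represents, it may revisit a node, but a link from a node to itself
  is not a link.\<close>

definition paths :: "'v set \<Rightarrow> 'v \<Rightarrow> 'v \<Rightarrow> 'v list set" where
  "paths V i j =
     {p. set p \<subseteq> V \<and> 2 \<le> length p \<and> distinct_adj p \<and> hd p = i \<and> last p = j}"

fun path_cost :: "(real \<Rightarrow> real \<Rightarrow> real) \<Rightarrow> ('v \<Rightarrow> 'v \<Rightarrow> real) \<Rightarrow> 'v list \<Rightarrow> real" where
  "path_cost f w (u # v # x # p) = f (w u v) (path_cost f w (v # x # p))"
| "path_cost f w [u, v] = w u v"
| "path_cost f w [u] = 0"
| "path_cost f w [] = 0"

text \<open>Single links are the paths with two nodes.\<close>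

definition costs :: "'v set \<Rightarrow> (real \<Rightarrow> real \<Rightarrow> real) \<Rightarrow> ('v \<Rightarrow> 'v \<Rightarrow> real) \<Rightarrow> real set" where
  "costs V f w = {path_cost f w p | p i j. i \<in> V \<and> j \<in> V \<and> p \<in> paths V i j}"

text \<open>The composition is an operation on the nonnegative reals; its values elsewhere are
  irrelevant. The triangle inequality and isotonicity are required for genuine links only:
  admitting the cost \<open>0\<close> of a link from a node to itself would give
  \<open>w i j \<le> w i i \<oplus> w i j = min 0 (w i j) = 0\<close> for the composition \<open>min\<close>, so that no concave
  metric on two or more nodes would exist. In \<open>optimal\<close>, the direct path \<open>[i, j]\<close> attains the
  bound, so \<open>w i j\<close> is the minimum of the costs of the paths from \<open>i\<close> to \<open>j\<close>.\<close>

locale entangling_metric =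
  fixes V :: "'v set"
    and w :: "'v \<Rightarrow> 'v \<Rightarrow> real"
    and comp :: "real \<Rightarrow> real \<Rightarrow> real" (infixl "\<oplus>" 65)
  assumes comp_nonneg: "\<lbrakk>0 \<le> a; 0 \<le> b\<rbrakk> \<Longrightarrow> 0 \<le> a \<oplus> b"
    and comp_assoc: "\<lbrakk>0 \<le> a; 0 \<le> b; 0 \<le> c\<rbrakk> \<Longrightarrow> (a \<oplus> b) \<oplus> c = a \<oplus> (b \<oplus> c)"
    and definite: "\<lbrakk>i \<in> V; j \<in> V\<rbrakk> \<Longrightarrow> w i j = 0 \<longleftrightarrow> i = j"
    and nonneg: "\<lbrakk>i \<in> V; j \<in> V\<rbrakk> \<Longrightarrow> 0 \<le> w i j"
    and symmetric: "\<lbrakk>i \<in> V; j \<in> V\<rbrakk> \<Longrightarrow> w i j = w j i"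
    and triangle: "\<lbrakk>i \<in> V; j \<in> V; k \<in> V; k \<noteq> i; k \<noteq> j\<rbrakk> \<Longrightarrow> w i j \<le> w i k \<oplus> w k j"
    and left_isotone:
      "\<lbrakk>a \<in> costs V (\<oplus>) w; b \<in> costs V (\<oplus>) w; c \<in> costs V (\<oplus>) w; a < b\<rbrakk>
        \<Longrightarrow> c \<oplus> a < c \<oplus> b"
    and right_isotone:
      "\<lbrakk>a \<in> costs V (\<oplus>) w; b \<in> costs V (\<oplus>) w; c \<in> costs V (\<oplus>) w; a < b\<rbrakk>
        \<Longrightarrow> a \<oplus> c < b \<oplus> c"
    and optimal:
      "\<lbrakk>i \<in> V; j \<in> V; i \<noteq> j; p \<in> paths V i j\<rbrakk> \<Longrightarrow> w i j \<le> path_cost (\<oplus>) w p"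

text \<open>A node may or may not belong to its own neighborhood.\<close>

definition e_neighborhoods ::
    "'v set \<Rightarrow> ('v \<Rightarrow> 'v \<Rightarrow> real) \<Rightarrow> nat \<Rightarrow> ('v \<Rightarrow> 'v set) \<Rightarrow> bool" where
  "e_neighborhoods V w k N \<longleftrightarrow>
     (\<forall>v\<in>V. N v \<subseteq> V \<and> card (N v) = k \<and>
        (\<forall>x\<in>N v. \<forall>y\<in>V - N v. y \<noteq> v \<longrightarrow> w v x \<le> w v y))"

definition share_link :: "('v \<Rightarrow> 'v set) \<Rightarrow> 'v set \<Rightarrow> 'v \<Rightarrow> 'v \<Rightarrow> bool" where
  "share_link N T i d \<longleftrightarrow> d \<in> N i \<or> i \<in> N d \<or> (i \<in> T \<and> d \<in> T)"

definition anchor_for :: "('v \<Rightarrow> 'v set) \<Rightarrow> 'v set \<Rightarrow> 'v \<Rightarrow> 'v \<Rightarrow> bool" where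
  "anchor_for N T i l \<longleftrightarrow> (if i \<in> T then l = i else l \<in> T \<inter> N i)"

text \<open>The set of paths the protocol may select from \<open>i\<close> to \<open>d\<close>. Here \<open>remdups_adj\<close> omits the
  links from a node to itself.\<close>

definition partial_anchor_paths :: "('v \<Rightarrow> 'v set) \<Rightarrow> 'v set \<Rightarrow> 'v \<Rightarrow> 'v \<Rightarrow> 'v list set" where
  "partial_anchor_paths N T i d =
     (if share_link N T i d then {[i, d]}
      else if \<exists>j\<in>N i. d \<in> N j then {[i, j, d] | j. j \<in> N i \<and> d \<in> N j}
      else {remdups_adj [i, l, k, d] | l k. anchor_for N T i l \<and> anchor_for N T d k})"

definition partial_anchor_protocol ::
    "'v set \<Rightarrow> ('v \<Rightarrow> 'v set) \<Rightarrow> 'v set \<Rightarrow> ('v \<Rightarrow> 'v \<Rightarrow> 'v list) \<Rightarrow> bool" where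
  "partial_anchor_protocol V N T QR \<longleftrightarrow>
     (\<forall>i\<in>V. \<forall>d\<in>V. i \<noteq> d \<longrightarrow> QR i d \<in> partial_anchor_paths N T i d)"

definition stretch ::
    "(real \<Rightarrow> real \<Rightarrow> real) \<Rightarrow> ('v \<Rightarrow> 'v \<Rightarrow> real) \<Rightarrow> ('v \<Rightarrow> 'v \<Rightarrow> 'v list) \<Rightarrow> 'v \<Rightarrow> 'v \<Rightarrow> real" where
  "stretch f w QR i j = path_cost f w (QR i j) / w i j"

definition overall_stretch ::
    "'v set \<Rightarrow> (real \<Rightarrow> real \<Rightarrow> real) \<Rightarrow> ('v \<Rightarrow> 'v \<Rightarrow> real) \<Rightarrow> ('v \<Rightarrow> 'v \<Rightarrow> 'v list) \<Rightarrow> real" where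
  "overall_stretch V f w QR = Max {stretch f w QR a b | a b. a \<in> V \<and> b \<in> V \<and> a \<noteq> b}"

end

theory Submission
  imports Defs
begin

text \<open>Write \<open>x = w i d\<close>. Unless \<open>i\<close> and \<open>d\<close> share a link, each lies outside the other's
  neighborhood, so the first link of the selected path costs at most \<open>x\<close>, and in the anchor case
  so does the last one. Going around through \<open>i\<close> and \<open>d\<close> bounds the remaining link by at
  most a threefold composition of \<open>x\<close>, which makes at most five in total. Shorter compositions are
  bounded by the fivefold one because \<open>x \<le> x \<oplus> x\<close>.\<close>

context entangling_metric
begin

lemma path_cost_in_costs:
  assumes "set p \<subseteq> V" "2 \<le> length p" "distinct_adj p"
  shows "path_cost (\<oplus>) w p \<in> costs V (\<oplus>) w"
proof -
  have "p \<noteq> []"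
    using assms(2) by auto
  then have "hd p \<in> V" "last p \<in> V"
    using assms(1) by auto
  then show ?thesis
    using assms unfolding costs_def paths_def by blast
qed

lemma link_cost: "\<lbrakk>i \<in> V; j \<in> V; i \<noteq> j\<rbrakk> \<Longrightarrow> w i j \<in> costs V (\<oplus>) w"
  using path_cost_in_costs[of "[i, j]"] by simp

lemma left_mono:
  assumes "a \<in> costs V (\<oplus>) w" "b \<in> costs V (\<oplus>) w" "c \<in> costs V (\<oplus>) w" "a \<le> b"
  shows "c \<oplus> a \<le> c \<oplus> b"
  using left_isotone[OF assms(1-3)] assms(4) by (cases "a = b") auto

lemma right_mono:
  assumes "a \<in> costs V (\<oplus>) w" "b \<in> costs V (\<oplus>) w" "c \<in> costs V (\<oplus>) w" "a \<le> b"
  shows "a \<oplus> c \<le> b \<oplus> c"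
  using right_isotone[OF assms(1-3)] assms(4) by (cases "a = b") auto

text \<open>These are the costs of the walks going back and forth between \<open>i\<close> and
  \<open>d\<close>. Membership matters because isotonicity is assumed only for costs of paths; the
  right-nested form is the one that \<open>path_cost\<close> produces.\<close>

lemma link_powers_in_costs:
  assumes "i \<in> V" "d \<in> V" "i \<noteq> d"
  defines "x \<equiv> w i d"
  shows "x \<in> costs V (\<oplus>) w" "x \<oplus> x \<in> costs V (\<oplus>) w" "x \<oplus> (x \<oplus> x) \<in> costs V (\<oplus>) w"
    "x \<oplus> (x \<oplus> (x \<oplus> x)) \<in> costs V (\<oplus>) w" "x \<oplus> (x \<oplus> (x \<oplus> (x \<oplus> x))) \<in> costs V (\<oplus>) w"
  using assms symmetric[OF assms(1,2)] path_cost_in_costs[of "[i, d]"]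
    path_cost_in_costs[of "[i, d, i]"] path_cost_in_costs[of "[i, d, i, d]"]
    path_cost_in_costs[of "[i, d, i, d, i]"] path_cost_in_costs[of "[i, d, i, d, i, d]"]
  by simp_all

text \<open>Otherwise isotonicity would yield \<open>x \<oplus> (x \<oplus> x) < x \<oplus> x < x\<close>, so that going back and
  forth between \<open>i\<close> and \<open>d\<close> would beat the direct link.\<close>

lemma link_le_double:
  assumes "i \<in> V" "d \<in> V" "i \<noteq> d"
  shows "w i d \<le> w i d \<oplus> w i d"
proof (rule ccontr)
  let ?x = "w i d"
  assume less: "\<not> ?x \<le> ?x \<oplus> ?x"
  then have "?x \<oplus> (?x \<oplus> ?x) < ?x \<oplus> ?x"
    using left_isotone[of "?x \<oplus> ?x" ?x ?x] link_powers_in_costs[OF assms] by simp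
  moreover have "?x \<le> ?x \<oplus> (?x \<oplus> ?x)"
    using optimal[OF assms, of "[i, d, i, d]"] assms symmetric[of i d] by (simp add: paths_def)
  ultimately show False
    using less by simp
qed

lemma link_powers_mono:
  assumes "i \<in> V" "d \<in> V" "i \<noteq> d"
  defines "x \<equiv> w i d"
  shows "x \<oplus> x \<le> x \<oplus> (x \<oplus> x)" "x \<oplus> (x \<oplus> x) \<le> x \<oplus> (x \<oplus> (x \<oplus> x))"
    "x \<oplus> (x \<oplus> (x \<oplus> x)) \<le> x \<oplus> (x \<oplus> (x \<oplus> (x \<oplus> x)))"
proof -
  note in_costs = link_powers_in_costs[OF assms(1-3), folded x_def]
  show 2: "x \<oplus> x \<le> x \<oplus> (x \<oplus> x)"
    by (rule left_mono[OF in_costs(1,2,1) link_le_double[OF assms(1-3), folded x_def]])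
  show 3: "x \<oplus> (x \<oplus> x) \<le> x \<oplus> (x \<oplus> (x \<oplus> x))"
    by (rule left_mono[OF in_costs(2,3,1) 2])
  show "x \<oplus> (x \<oplus> (x \<oplus> x)) \<le> x \<oplus> (x \<oplus> (x \<oplus> (x \<oplus> x)))"
    by (rule left_mono[OF in_costs(3,4,1) 3])
qed

text \<open>From \<open>j\<close>, the node \<open>d\<close> can be reached by a detour through the
  nearby \<open>i\<close>, so the link between them costs at most \<open>x \<oplus> x\<close>. As
  \<oplus> need not commute, the reversed path is treated too; it serves paths whose intermediate
  node is near the target.\<close>

lemma two_link_path_le:
  assumes "i \<in> V" "d \<in> V" "j \<in> V" "i \<noteq> d" "j \<noteq> i" "j \<noteq> d" and near: "w i j \<le> w i d"
  defines "x \<equiv> w i d"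
  shows "w i j \<oplus> w j d \<le> x \<oplus> (x \<oplus> x)" "w d j \<oplus> w j i \<le> x \<oplus> (x \<oplus> x)"
proof -
  note in_costs = link_powers_in_costs[OF assms(1,2,4), folded x_def]
  have links: "w i j \<in> costs V (\<oplus>) w" "w j d \<in> costs V (\<oplus>) w"
    using assms by (auto intro: link_cost)
  have x0: "0 \<le> x"
    using nonneg assms by simp
  have "w j d \<le> w j i \<oplus> w i d"
    using triangle[of j d i] assms by simp
  also have "\<dots> \<le> x \<oplus> x"
    using right_mono[of "w i j" x x] links in_costs near symmetric[of i j] assms(1,3)
    by (simp add: x_def)
  finally have far: "w j d \<le> x \<oplus> x" .
  have "w i j \<oplus> w j d \<le> w i j \<oplus> (x \<oplus> x)"
    by (rule left_mono[OF links(2) in_costs(2) links(1) far])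
  also have "\<dots> \<le> x \<oplus> (x \<oplus> x)"
    using right_mono[OF links(1) in_costs(1,2)] near by (simp add: x_def)
  finally show "w i j \<oplus> w j d \<le> x \<oplus> (x \<oplus> x)" .
  \<comment> \<open>By symmetry of \<open>w\<close>, the left-hand side is the cost of
    \<open>[d, j, i]\<close>.\<close>
  have "w j d \<oplus> w i j \<le> (x \<oplus> x) \<oplus> w i j"
    by (rule right_mono[OF links(2) in_costs(2) links(1) far])
  also have "\<dots> \<le> (x \<oplus> x) \<oplus> x"
    using left_mono[OF links(1) in_costs(1,2)] near by (simp add: x_def)
  finally show "w d j \<oplus> w j i \<le> x \<oplus> (x \<oplus> x)"
    using symmetric[of i j] symmetric[of d j] assms(1-3) comp_assoc[OF x0 x0 x0] by simp
qed

text \<open>The middle link competes with the walk \<open>[l, i, d, k]\<close>, each of whose links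
  costs at most \<open>x\<close>. Optimality is applied to this walk as a whole: only consecutive
  nodes must differ, so a coincidence such as \<open>l = d\<close> does no harm.\<close>

lemma three_link_path_le:
  assumes "i \<in> V" "d \<in> V" "l \<in> V" "k \<in> V" "i \<noteq> d" "l \<noteq> i" "k \<noteq> d" "l \<noteq> k"
    and near: "w i l \<le> w i d" "w k d \<le> w i d"
  defines "x \<equiv> w i d"
  shows "w i l \<oplus> (w l k \<oplus> w k d) \<le> x \<oplus> (x \<oplus> (x \<oplus> (x \<oplus> x)))"
proof -
  note in_costs = link_powers_in_costs[OF assms(1,2,5), folded x_def]
  have links: "w i l \<in> costs V (\<oplus>) w" "w l k \<in> costs V (\<oplus>) w" "w k d \<in> costs V (\<oplus>) w"
    using assms by (auto intro: link_cost)
  have x0: "0 \<le> x"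
    using nonneg assms by simp
  \<comment> \<open>Composite tails are exhibited as path costs, so that isotonicity covers
    them.\<close>
  have tail: "w i d \<oplus> w d k \<in> costs V (\<oplus>) w" "w l k \<oplus> w k d \<in> costs V (\<oplus>) w"
    using path_cost_in_costs[of "[i, d, k]"] path_cost_in_costs[of "[l, k, d]"] assms(1-8)
    by simp_all
  have "w l k \<le> w l i \<oplus> (w i d \<oplus> w d k)"
    using optimal[of l k "[l, i, d, k]"] assms(1-8) by (simp add: paths_def)
  also have "\<dots> \<le> x \<oplus> (w i d \<oplus> w d k)"
    using right_mono[OF links(1) in_costs(1) tail(1)] near symmetric[of i l] assms(1,3)
    by (simp add: x_def)
  also have "\<dots> \<le> x \<oplus> (x \<oplus> x)"
  proof (rule left_mono[OF tail(1) in_costs(2,1)])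
    show "w i d \<oplus> w d k \<le> x \<oplus> x"
      using left_mono[OF links(3) in_costs(1,1)] near symmetric[of d k] assms(2,4)
      by (simp add: x_def)
  qed
  finally have middle: "w l k \<le> x \<oplus> (x \<oplus> x)" .
  have "w l k \<oplus> w k d \<le> (x \<oplus> (x \<oplus> x)) \<oplus> w k d"
    by (rule right_mono[OF links(2) in_costs(3) links(3) middle])
  also have "\<dots> \<le> (x \<oplus> (x \<oplus> x)) \<oplus> x"
    using left_mono[OF links(3) in_costs(1,3)] near by (simp add: x_def)
  also have "\<dots> = x \<oplus> (x \<oplus> (x \<oplus> x))"
    using x0 by (simp add: comp_assoc comp_nonneg)
  finally have "w i l \<oplus> (w l k \<oplus> w k d) \<le> w i l \<oplus> (x \<oplus> (x \<oplus> (x \<oplus> x)))"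
    by (rule left_mono[OF tail(2) in_costs(4) links(1)])
  also have "\<dots> \<le> x \<oplus> (x \<oplus> (x \<oplus> (x \<oplus> x)))"
    using right_mono[OF links(1) in_costs(1,4)] near by (simp add: x_def)
  finally show ?thesis .
qed

text \<open>Membership in \<open>paths\<close> later lets optimality bound the stretch from below.
  The estimates use right-nested compositions, and associativity restores the left-nested form at
  the end.\<close>

lemma partial_anchor_path_le:
  assumes nbh: "e_neighborhoods V w n N" and "T \<subseteq> V" "i \<in> V" "d \<in> V" "i \<noteq> d"
    and p: "p \<in> partial_anchor_paths N T i d"
  shows "p \<in> paths V i d"
    and "path_cost (\<oplus>) w p \<le> w i d \<oplus> w i d \<oplus> w i d \<oplus> w i d \<oplus> w i d"
proof -
  let ?x = "w i d"
  let ?x5 = "?x \<oplus> (?x \<oplus> (?x \<oplus> (?x \<oplus> ?x)))"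
  note in_costs = link_powers_in_costs[OF assms(3-5)]
  note mono = link_le_double[OF assms(3-5)] link_powers_mono[OF assms(3-5)]
  have x0: "0 \<le> ?x"
    using nonneg assms by simp
  have NV: "N v \<subseteq> V" if "v \<in> V" for v
    using nbh that unfolding e_neighborhoods_def by blast
  have near: "w v u \<le> w v y" if "v \<in> V" "y \<in> V" "u \<in> N v" "y \<notin> N v" "y \<noteq> v" for u v y
    using nbh that unfolding e_neighborhoods_def by blast
  have "p \<in> paths V i d \<and> path_cost (\<oplus>) w p \<le> ?x5"
  proof (cases "share_link N T i d")
    case True
    then have "p = [i, d]"
      using p by (simp add: partial_anchor_paths_def)
    then show ?thesis
      using assms(3-5) mono by (simp add: paths_def)
  next
    case unshared: False
    then have notin: "d \<notin> N i" "i \<notin> N d" "\<not> (i \<in> T \<and> d \<in> T)"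
      by (auto simp: share_link_def)
    show ?thesis
    proof (cases "\<exists>j\<in>N i. d \<in> N j")
      case True
      then obtain j where j: "p = [i, j, d]" "j \<in> N i" "d \<in> N j"
        using p unshared by (auto simp: partial_anchor_paths_def)
      \<comment> \<open>Both \<open>j = i\<close>, by \<open>d \<in> N j\<close>, and
        \<open>j = d\<close>, by \<open>j \<in> N i\<close>, would put \<open>d\<close> into
        \<open>N i\<close>.\<close>
      have "j \<in> V" "j \<noteq> i" "j \<noteq> d" "w i j \<le> ?x"
        using j notin NV near[of i d j] assms(3-5) by auto
      then show ?thesis
        using two_link_path_le(1)[of i d j] mono j(1) assms(3-5) by (simp add: paths_def)
    next
      case False
      then obtain l k where lk: "p = remdups_adj [i, l, k, d]"
          "anchor_for N T i l" "anchor_for N T d k"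
        using p unshared by (auto simp: partial_anchor_paths_def)
      \<comment> \<open>Here \<open>l\<close> differs from \<open>i\<close> because only
        \<open>l\<close> is an anchor, even if \<open>i \<in> N i\<close>, and from \<open>d\<close>
        because \<open>d\<close> lies outside \<open>N i\<close>.\<close>
      have l: "l \<in> V" "l \<noteq> i \<and> l \<noteq> d \<and> w i l \<le> ?x" if "i \<notin> T"
        using that lk(2) notin NV near[of i d l] assms(2-5)
        by (auto simp: anchor_for_def)
      have k: "k \<in> V" "k \<noteq> i \<and> k \<noteq> d \<and> w d k \<le> w d i \<and> w k d \<le> ?x" if "d \<notin> T"
        using that lk(3) notin NV near[of d i k] symmetric[of d i] symmetric[of d k] assms(2-5)
        by (auto simp: anchor_for_def)
      \<comment> \<open>Two anchors would share a link. In the first three cases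
        \<open>remdups_adj\<close> drops exactly one link, leaving two; in the last all three
        remain.\<close>
      consider "i \<in> T" "d \<notin> T" | "i \<notin> T" "d \<in> T" | "i \<notin> T" "d \<notin> T" "l = k"
        | "i \<notin> T" "d \<notin> T" "l \<noteq> k"
        using notin by blast
      then show ?thesis
      proof cases
        \<comment> \<open>The intermediate node \<open>k\<close> is near the target, so the two-link
          bound is used in its reversed form with the end points exchanged.\<close>
        case 1
        then have "l = i"
          using lk(2) by (simp add: anchor_for_def)
        then show ?thesis
          using two_link_path_le(2)[of d i k] k 1 mono lk(1) assms(3-5) symmetric[of d i]
          by (auto simp: paths_def)
      next
        case 2
        then have "k = d"
          using lk(3) by (simp add: anchor_for_def)
        then show ?thesis
          using two_link_path_le(1)[of i d l] l 2 mono lk(1) assms(3-5)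
          by (auto simp: paths_def)
      next
        case 3
        then show ?thesis
          using two_link_path_le(1)[of i d l] l mono lk(1) assms(3-5)
          by (auto simp: paths_def)
      next
        case 4
        then show ?thesis
          using three_link_path_le[of i d l k] l k lk(1) assms(3-5)
          by (auto simp: paths_def)
      qed
    qed
  qed
  then show "p \<in> paths V i d" "path_cost (\<oplus>) w p \<le> ?x \<oplus> ?x \<oplus> ?x \<oplus> ?x \<oplus> ?x"
    using x0 by (simp_all add: comp_assoc comp_nonneg)
qed

end

text \<open>The maximum ranges over a finite set, nonempty because there are two distinct nodes. A
  worst-case pair lets pairwise bounds pass to the overall stretch.\<close>

lemma overall_stretch_attained:
  assumes "finite V" "2 \<le> card V"
  obtains a b where "a \<in> V" "b \<in> V" "a \<noteq> b" "stretch f w QR a b = overall_stretch V f w QR"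
proof -
  let ?S = "{stretch f w QR a b | a b. a \<in> V \<and> b \<in> V \<and> a \<noteq> b}"
  have "?S \<subseteq> (\<lambda>(a, b). stretch f w QR a b) ` (V \<times> V)"
    by auto
  then have "finite ?S"
    using assms(1) by (meson finite_SigmaI finite_imageI finite_subset)
  moreover obtain a b where "a \<in> V" "b \<in> V" "a \<noteq> b"
    using assms card_le_Suc0_iff_eq[of V] by fastforce
  then have "?S \<noteq> {}"
    by blast
  ultimately have "Max ?S \<in> ?S"
    by (rule Max_in)
  then show thesis
    using that unfolding overall_stretch_def by auto
qed

theorem lemma1:
  fixes V T :: "'v set"
    and w :: "'v \<Rightarrow> 'v \<Rightarrow> real"
    and comp :: "real \<Rightarrow> real \<Rightarrow> real" (infixl "\<oplus>" 65)
    and N :: "'v \<Rightarrow> 'v set"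
    and k :: nat
    and QR :: "'v \<Rightarrow> 'v \<Rightarrow> 'v list"
  assumes "finite V" and "2 \<le> card V"
    and "entangling_metric V w (\<oplus>)"
    and "0 < k" and "e_neighborhoods V w k N"
    and "T \<subseteq> V" and "\<And>v. v \<in> V \<Longrightarrow> N v \<inter> T \<noteq> {}"
    and "partial_anchor_protocol V N T QR"
  shows "(\<forall>i\<in>V. \<forall>d\<in>V. i \<noteq> d \<and> stretch (\<oplus>) w QR i d = overall_stretch V (\<oplus>) w QR \<longrightarrow>
            overall_stretch V (\<oplus>) w QR
              \<le> (w i d \<oplus> w i d \<oplus> w i d \<oplus> w i d \<oplus> w i d) / w i d)
       \<and> ((\<forall>a\<ge>0. \<forall>b\<ge>0. a \<oplus> b = a + b) \<longrightarrow> overall_stretch V (\<oplus>) w QR \<le> 5)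
       \<and> ((\<forall>a\<ge>0. \<forall>b\<ge>0. a \<oplus> b = min a b) \<longrightarrow> overall_stretch V (\<oplus>) w QR = 1)"
proof -
  interpret entangling_metric V w "(\<oplus>)"
    by fact
  let ?S = "overall_stretch V (\<oplus>) w QR"
  have select: "QR i d \<in> partial_anchor_paths N T i d" if "i \<in> V" "d \<in> V" "i \<noteq> d" for i d
    using assms(8) that unfolding partial_anchor_protocol_def by blast
  have pos: "0 < w i d" if "i \<in> V" "d \<in> V" "i \<noteq> d" for i d
    using nonneg[of i d] definite[of i d] that by simp
  have upper: "stretch (\<oplus>) w QR i d \<le> (w i d \<oplus> w i d \<oplus> w i d \<oplus> w i d \<oplus> w i d) / w i d"
    if "i \<in> V" "d \<in> V" "i \<noteq> d" for i d
    unfolding stretch_def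
    using partial_anchor_path_le(2)[OF assms(5,6) that select[OF that]] pos[OF that]
    by (intro divide_right_mono) auto
  obtain a b where ab: "a \<in> V" "b \<in> V" "a \<noteq> b" and max: "stretch (\<oplus>) w QR a b = ?S"
    using overall_stretch_attained[OF assms(1,2)] .
  note w_pos = pos[OF ab]
  have "?S \<le> (w i d \<oplus> w i d \<oplus> w i d \<oplus> w i d \<oplus> w i d) / w i d"
    if "i \<in> V" "d \<in> V" "i \<noteq> d" "stretch (\<oplus>) w QR i d = ?S" for i d
    using upper[OF that(1-3)] that(4) by simp
  moreover have "?S \<le> 5" if "\<forall>a\<ge>0. \<forall>b\<ge>0. a \<oplus> b = a + b"
    using upper[OF ab] max w_pos that by simp
  moreover have "?S = 1" if "\<forall>a\<ge>0. \<forall>b\<ge>0. a \<oplus> b = min a b"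
  proof (rule antisym)
    \<comment> \<open>The fivefold minimum of \<open>w a b\<close> is \<open>w a b\<close>
      itself.\<close>
    show "?S \<le> 1"
      using upper[OF ab] max w_pos that by simp
    \<comment> \<open>Conversely, no path is cheaper than the direct link.\<close>
    have "w a b \<le> path_cost (\<oplus>) w (QR a b)"
      by (rule optimal[OF ab partial_anchor_path_le(1)[OF assms(5,6) ab select[OF ab]]])
    then have "1 \<le> stretch (\<oplus>) w QR a b"
      using w_pos by (simp add: stretch_def)
    then show "1 \<le> ?S"
      using max by simp
  qed
  ultimately show ?thesis
    by blast
qed

end
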